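(* Let $\mathcal C$ be a category with two symmetric monoidal structures $(\oplus,0)$ and $(\otimes,1)$ together with distributivity morphisms $\delta,\delta^\#,\lambda^*,\rho^*$ as described in the context, where $\delta,\delta^\#$ are natural monomorphisms (Laplaza's original context) or natural isomorphisms (the isomorphism-bound version of his context), $\lambda^*,\rho^*$ are natural isomorphisms, and $\lambda^*_A=\gamma^\otimes_{0,A};\rho^*_A$ for every object $A$ (Laplaza's condition XV). In either context, Laplaza's requirement XVIII implies his requirement XVII. That is, if for all objects $A,B$ $$\rho^*_{A\otimes B}=\alpha^\otimes_{A,B,0};(1_A\otimes\rho^*_B);\rho^*_A:(A\otimes B)\otimes 0\to 0,\qquad\text{(XVIII)}$$ then for all objects $A,B$ $$(\rho^*_A\otimes 1_B);\lambda^*_B=\alpha^\otimes_{A,0,B};(1_A\otimes\lambda^*_B);\rho^*_A:(A\otimes 0)\otimes B\to 0.\qquad\text{(XVII)}$$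
   Context: Composition is written left to right: $f;g$ means first $f$, then $g$. The multiplicative associativity isomorphism is $\alpha^\otimes_{A,B,C}:(A\otimes B)\otimes C\to A\otimes(B\otimes C)$ and the multiplicative symmetry is $\gamma^\otimes_{A,B}:A\otimes B\to B\otimes A$. Laplaza's setting: a category $\mathcal C$ with two symmetric monoidal structures, $\oplus$ with unit $0$ and $\otimes$ with unit $1$ (each satisfying the usual symmetric monoidal coherence conditions), and natural distributivity morphisms $\delta_{A,B,C}:A\otimes(B\oplus C)\to(A\otimes B)\oplus(A\otimes C)$, $\delta^\#_{A,B,C}:(A\oplus B)\otimes C\to(A\otimes C)\oplus(B\otimes C)$, $\lambda^*_A:0\otimes A\to 0$, $\rho^*_A:A\otimes 0\to 0$. In Laplaza's original context $\delta,\delta^\#$ are monomorphisms; in the isomorphism-bound version they are isomorphisms. In both contexts $\lambda^*$ and $\rho^*$ are isomorphisms. The right-hand nullary distributivity is related to the left-hand one by commutativity of $\otimes$ (condition XV): $\lambda^*_A=\gamma^\otimes_{0,A};\rho^*_A$. *)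

theory Defs
  imports Main
begin

text \<open>
  Composition is in diagrammatic order: \<open>f \<Zcomp> g\<close> is first \<open>f\<close>, then \<open>g\<close>.
\<close>

record ('o, 'a) category =
  Obj :: "'o set"
  Arr :: "'a set"
  Dom :: "'a \<Rightarrow> 'o"
  Cod :: "'a \<Rightarrow> 'o"
  ident :: "'o \<Rightarrow> 'a" ("\<^bold>1\<index>")
  comp :: "'a \<Rightarrow> 'a \<Rightarrow> 'a" (infixl "\<Zcomp>\<index>" 55)

definition hom :: "('o, 'a, 'z) category_scheme \<Rightarrow> 'o \<Rightarrow> 'o \<Rightarrow> 'a set" ("Hom\<index>") where
  "Hom\<^bsub>C\<^esub> A B = {f \<in> Arr C. Dom C f = A \<and> Cod C f = B}"

locale category =
  fixes C :: "('o, 'a, 'z) category_scheme" (structure)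
  assumes dom_obj: "f \<in> Arr C \<Longrightarrow> Dom C f \<in> Obj C"
    and cod_obj: "f \<in> Arr C \<Longrightarrow> Cod C f \<in> Obj C"
    and ident_hom: "A \<in> Obj C \<Longrightarrow> \<^bold>1 A \<in> Hom A A"
    and comp_hom: "\<lbrakk>f \<in> Hom A B; g \<in> Hom B D\<rbrakk> \<Longrightarrow> f \<Zcomp> g \<in> Hom A D"
    and ident_comp: "f \<in> Hom A B \<Longrightarrow> \<^bold>1 A \<Zcomp> f = f"
    and comp_ident: "f \<in> Hom A B \<Longrightarrow> f \<Zcomp> \<^bold>1 B = f"
    and comp_assoc: "\<lbrakk>f \<in> Hom A B; g \<in> Hom B D; h \<in> Hom D E\<rbrakk>
          \<Longrightarrow> (f \<Zcomp> g) \<Zcomp> h = f \<Zcomp> (g \<Zcomp> h)"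

definition is_mono :: "('o, 'a, 'z) category_scheme \<Rightarrow> 'o \<Rightarrow> 'o \<Rightarrow> 'a \<Rightarrow> bool" where
  "is_mono C A B f \<longleftrightarrow> f \<in> Hom\<^bsub>C\<^esub> A B \<and>
     (\<forall>X \<in> Obj C. \<forall>g \<in> Hom\<^bsub>C\<^esub> X A. \<forall>h \<in> Hom\<^bsub>C\<^esub> X A. g \<Zcomp>\<^bsub>C\<^esub> f = h \<Zcomp>\<^bsub>C\<^esub> f \<longrightarrow> g = h)"

definition is_iso :: "('o, 'a, 'z) category_scheme \<Rightarrow> 'o \<Rightarrow> 'o \<Rightarrow> 'a \<Rightarrow> bool" where
  "is_iso C A B f \<longleftrightarrow> f \<in> Hom\<^bsub>C\<^esub> A B \<and>
     (\<exists>g \<in> Hom\<^bsub>C\<^esub> B A. f \<Zcomp>\<^bsub>C\<^esub> g = \<^bold>1\<^bsub>C\<^esub> A \<and> g \<Zcomp>\<^bsub>C\<^esub> f = \<^bold>1\<^bsub>C\<^esub> B)"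

text \<open>
  The operation on objects is \<open>\<odot>\<close>, its action on arrows \<open>\<odot>\<^sub>a\<close>. The coherence conditions are
  those of Mac Lane: pentagon, triangle, symmetry, unit condition for the symmetry, hexagon.
\<close>

locale symmetric_monoidal_category = category C
  for C :: "('o, 'a, 'z) category_scheme" (structure) +
  fixes ten :: "'o \<Rightarrow> 'o \<Rightarrow> 'o" (infixl "\<odot>" 70)
    and tena :: "'a \<Rightarrow> 'a \<Rightarrow> 'a" (infixl "\<odot>\<^sub>a" 70)
    and unit :: 'o ("\<I>")
    and \<alpha> :: "'o \<Rightarrow> 'o \<Rightarrow> 'o \<Rightarrow> 'a"
    and lunit :: "'o \<Rightarrow> 'a" ("\<l>")
    and runit :: "'o \<Rightarrow> 'a" ("\<r>")
    and \<gamma> :: "'o \<Rightarrow> 'o \<Rightarrow> 'a"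
  assumes ten_obj: "\<lbrakk>A \<in> Obj C; B \<in> Obj C\<rbrakk> \<Longrightarrow> A \<odot> B \<in> Obj C"
    and tena_hom: "\<lbrakk>f \<in> Hom A A'; g \<in> Hom B B'\<rbrakk> \<Longrightarrow> f \<odot>\<^sub>a g \<in> Hom (A \<odot> B) (A' \<odot> B')"
    and tena_ident: "\<lbrakk>A \<in> Obj C; B \<in> Obj C\<rbrakk> \<Longrightarrow> \<^bold>1 A \<odot>\<^sub>a \<^bold>1 B = \<^bold>1 (A \<odot> B)"
    and tena_comp: "\<lbrakk>f \<in> Hom A A'; f' \<in> Hom A' A''; g \<in> Hom B B'; g' \<in> Hom B' B''\<rbrakk>
          \<Longrightarrow> (f \<Zcomp> f') \<odot>\<^sub>a (g \<Zcomp> g') = (f \<odot>\<^sub>a g) \<Zcomp> (f' \<odot>\<^sub>a g')"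
    and unit_obj: "\<I> \<in> Obj C"
    and \<alpha>_iso: "\<lbrakk>A \<in> Obj C; B \<in> Obj C; D \<in> Obj C\<rbrakk>
          \<Longrightarrow> is_iso C ((A \<odot> B) \<odot> D) (A \<odot> (B \<odot> D)) (\<alpha> A B D)"
    and \<alpha>_natural: "\<lbrakk>f \<in> Hom A A'; g \<in> Hom B B'; h \<in> Hom D D'\<rbrakk>
          \<Longrightarrow> ((f \<odot>\<^sub>a g) \<odot>\<^sub>a h) \<Zcomp> \<alpha> A' B' D' = \<alpha> A B D \<Zcomp> (f \<odot>\<^sub>a (g \<odot>\<^sub>a h))"
    and lunit_iso: "A \<in> Obj C \<Longrightarrow> is_iso C (\<I> \<odot> A) A (\<l> A)"
    and lunit_natural: "f \<in> Hom A A' \<Longrightarrow> (\<^bold>1 \<I> \<odot>\<^sub>a f) \<Zcomp> \<l> A' = \<l> A \<Zcomp> f"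
    and runit_iso: "A \<in> Obj C \<Longrightarrow> is_iso C (A \<odot> \<I>) A (\<r> A)"
    and runit_natural: "f \<in> Hom A A' \<Longrightarrow> (f \<odot>\<^sub>a \<^bold>1 \<I>) \<Zcomp> \<r> A' = \<r> A \<Zcomp> f"
    and \<gamma>_iso: "\<lbrakk>A \<in> Obj C; B \<in> Obj C\<rbrakk> \<Longrightarrow> is_iso C (A \<odot> B) (B \<odot> A) (\<gamma> A B)"
    and \<gamma>_natural: "\<lbrakk>f \<in> Hom A A'; g \<in> Hom B B'\<rbrakk>
          \<Longrightarrow> (f \<odot>\<^sub>a g) \<Zcomp> \<gamma> A' B' = \<gamma> A B \<Zcomp> (g \<odot>\<^sub>a f)"
    and pentagon: "\<lbrakk>A \<in> Obj C; B \<in> Obj C; D \<in> Obj C; E \<in> Obj C\<rbrakk>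
          \<Longrightarrow> (\<alpha> A B D \<odot>\<^sub>a \<^bold>1 E) \<Zcomp> \<alpha> A (B \<odot> D) E \<Zcomp> (\<^bold>1 A \<odot>\<^sub>a \<alpha> B D E)
              = \<alpha> (A \<odot> B) D E \<Zcomp> \<alpha> A B (D \<odot> E)"
    and triangle: "\<lbrakk>A \<in> Obj C; B \<in> Obj C\<rbrakk>
          \<Longrightarrow> \<alpha> A \<I> B \<Zcomp> (\<^bold>1 A \<odot>\<^sub>a \<l> B) = \<r> A \<odot>\<^sub>a \<^bold>1 B"
    and symmetry: "\<lbrakk>A \<in> Obj C; B \<in> Obj C\<rbrakk> \<Longrightarrow> \<gamma> A B \<Zcomp> \<gamma> B A = \<^bold>1 (A \<odot> B)"
    and \<gamma>_unit: "A \<in> Obj C \<Longrightarrow> \<gamma> A \<I> \<Zcomp> \<l> A = \<r> A"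
    and hexagon: "\<lbrakk>A \<in> Obj C; B \<in> Obj C; D \<in> Obj C\<rbrakk>
          \<Longrightarrow> \<alpha> A B D \<Zcomp> \<gamma> A (B \<odot> D) \<Zcomp> \<alpha> B D A
              = (\<gamma> A B \<odot>\<^sub>a \<^bold>1 D) \<Zcomp> \<alpha> B A D \<Zcomp> (\<^bold>1 B \<odot>\<^sub>a \<gamma> A D)"

text \<open>
  \<open>\<lambda>\<^sup>\<otimes>\<close>, \<open>\<rho>\<^sup>\<otimes>\<close> (and likewise for \<open>\<oplus>\<close>) are the unitors; the nullary distributivities are
  \<open>\<lambda>\<^sup>*\<close>, \<open>\<rho>\<^sup>*\<close>.
\<close>

record ('o, 'a) bimonoidal = "('o, 'a) category" +
  plus_obj :: "'o \<Rightarrow> 'o \<Rightarrow> 'o" (infixl "\<oplus>\<index>" 65)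
  plus_arr :: "'a \<Rightarrow> 'a \<Rightarrow> 'a" (infixl "\<oplus>\<^sub>a\<index>" 65)
  zero_obj :: 'o ("\<zero>\<index>")
  plus_assoc :: "'o \<Rightarrow> 'o \<Rightarrow> 'o \<Rightarrow> 'a" ("\<alpha>\<^sup>\<oplus>\<index>")
  plus_lunit :: "'o \<Rightarrow> 'a" ("\<lambda>\<^sup>\<oplus>\<index>")
  plus_runit :: "'o \<Rightarrow> 'a" ("\<rho>\<^sup>\<oplus>\<index>")
  plus_sym :: "'o \<Rightarrow> 'o \<Rightarrow> 'a" ("\<gamma>\<^sup>\<oplus>\<index>")
  times_obj :: "'o \<Rightarrow> 'o \<Rightarrow> 'o" (infixl "\<otimes>\<index>" 70)
  times_arr :: "'a \<Rightarrow> 'a \<Rightarrow> 'a" (infixl "\<otimes>\<^sub>a\<index>" 70)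
  one_obj :: 'o ("\<one>\<index>")
  times_assoc :: "'o \<Rightarrow> 'o \<Rightarrow> 'o \<Rightarrow> 'a" ("\<alpha>\<^sup>\<otimes>\<index>")
  times_lunit :: "'o \<Rightarrow> 'a" ("\<lambda>\<^sup>\<otimes>\<index>")
  times_runit :: "'o \<Rightarrow> 'a" ("\<rho>\<^sup>\<otimes>\<index>")
  times_sym :: "'o \<Rightarrow> 'o \<Rightarrow> 'a" ("\<gamma>\<^sup>\<otimes>\<index>")
  ldistr :: "'o \<Rightarrow> 'o \<Rightarrow> 'o \<Rightarrow> 'a" ("\<delta>\<index>")
  rdistr :: "'o \<Rightarrow> 'o \<Rightarrow> 'o \<Rightarrow> 'a" ("\<delta>\<^sup>#\<index>")
  lnull :: "'o \<Rightarrow> 'a" ("\<lambda>\<^sup>*\<index>")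
  rnull :: "'o \<Rightarrow> 'a" ("\<rho>\<^sup>*\<index>")

locale distributive_setting =
  category L +
  plus: symmetric_monoidal_category L "(\<oplus>)" "(\<oplus>\<^sub>a)" "\<zero>" "\<alpha>\<^sup>\<oplus>" "\<lambda>\<^sup>\<oplus>" "\<rho>\<^sup>\<oplus>" "\<gamma>\<^sup>\<oplus>" +
  times: symmetric_monoidal_category L "(\<otimes>)" "(\<otimes>\<^sub>a)" "\<one>" "\<alpha>\<^sup>\<otimes>" "\<lambda>\<^sup>\<otimes>" "\<rho>\<^sup>\<otimes>" "\<gamma>\<^sup>\<otimes>"
  for L :: "('o, 'a, 'z) bimonoidal_scheme" (structure) +
  assumes ldistr_hom: "\<lbrakk>A \<in> Obj L; B \<in> Obj L; C \<in> Obj L\<rbrakk>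
          \<Longrightarrow> \<delta> A B C \<in> Hom (A \<otimes> (B \<oplus> C)) ((A \<otimes> B) \<oplus> (A \<otimes> C))"
    and ldistr_natural: "\<lbrakk>f \<in> Hom A A'; g \<in> Hom B B'; h \<in> Hom C C'\<rbrakk>
          \<Longrightarrow> (f \<otimes>\<^sub>a (g \<oplus>\<^sub>a h)) \<Zcomp> \<delta> A' B' C' = \<delta> A B C \<Zcomp> ((f \<otimes>\<^sub>a g) \<oplus>\<^sub>a (f \<otimes>\<^sub>a h))"
    and rdistr_hom: "\<lbrakk>A \<in> Obj L; B \<in> Obj L; C \<in> Obj L\<rbrakk>
          \<Longrightarrow> \<delta>\<^sup># A B C \<in> Hom ((A \<oplus> B) \<otimes> C) ((A \<otimes> C) \<oplus> (B \<otimes> C))"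
    and rdistr_natural: "\<lbrakk>f \<in> Hom A A'; g \<in> Hom B B'; h \<in> Hom C C'\<rbrakk>
          \<Longrightarrow> ((f \<oplus>\<^sub>a g) \<otimes>\<^sub>a h) \<Zcomp> \<delta>\<^sup># A' B' C' = \<delta>\<^sup># A B C \<Zcomp> ((f \<otimes>\<^sub>a h) \<oplus>\<^sub>a (g \<otimes>\<^sub>a h))"
    and lnull_iso: "A \<in> Obj L \<Longrightarrow> is_iso L (\<zero> \<otimes> A) \<zero> (\<lambda>\<^sup>* A)"
    and lnull_natural: "f \<in> Hom A A' \<Longrightarrow> (\<^bold>1 \<zero> \<otimes>\<^sub>a f) \<Zcomp> \<lambda>\<^sup>* A' = \<lambda>\<^sup>* A \<Zcomp> \<^bold>1 \<zero>"
    and rnull_iso: "A \<in> Obj L \<Longrightarrow> is_iso L (A \<otimes> \<zero>) \<zero> (\<rho>\<^sup>* A)"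
    and rnull_natural: "f \<in> Hom A A' \<Longrightarrow> (f \<otimes>\<^sub>a \<^bold>1 \<zero>) \<Zcomp> \<rho>\<^sup>* A' = \<rho>\<^sup>* A \<Zcomp> \<^bold>1 \<zero>"

locale laplaza_mono_setting = distributive_setting +
  assumes ldistr_mono: "\<lbrakk>A \<in> Obj L; B \<in> Obj L; C \<in> Obj L\<rbrakk>
          \<Longrightarrow> is_mono L (A \<otimes> (B \<oplus> C)) ((A \<otimes> B) \<oplus> (A \<otimes> C)) (\<delta> A B C)"
    and rdistr_mono: "\<lbrakk>A \<in> Obj L; B \<in> Obj L; C \<in> Obj L\<rbrakk>
          \<Longrightarrow> is_mono L ((A \<oplus> B) \<otimes> C) ((A \<otimes> C) \<oplus> (B \<otimes> C)) (\<delta>\<^sup># A B C)"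

locale laplaza_iso_setting = distributive_setting +
  assumes ldistr_iso: "\<lbrakk>A \<in> Obj L; B \<in> Obj L; C \<in> Obj L\<rbrakk>
          \<Longrightarrow> is_iso L (A \<otimes> (B \<oplus> C)) ((A \<otimes> B) \<oplus> (A \<otimes> C)) (\<delta> A B C)"
    and rdistr_iso: "\<lbrakk>A \<in> Obj L; B \<in> Obj L; C \<in> Obj L\<rbrakk>
          \<Longrightarrow> is_iso L ((A \<oplus> B) \<otimes> C) ((A \<otimes> C) \<oplus> (B \<otimes> C)) (\<delta>\<^sup># A B C)"

end

theory Submission
  imports Defs
begin

text \<open>
  Precompose both sides of XVII with the isomorphism
  \<open>\<alpha>\<^sup>\<otimes> B A \<zero> \<Zcomp> \<gamma>\<^sup>\<otimes> B (A \<otimes> \<zero>)\<close>. After XV and naturality of \<open>\<gamma>\<^sup>\<otimes>\<close>, XVIII turns the left side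
  into \<open>\<rho>\<^sup>* (B \<otimes> A)\<close>. By the hexagon and XVIII, the right side becomes
  \<open>(\<gamma>\<^sup>\<otimes> B A \<otimes>\<^sub>a \<^bold>1 \<zero>) \<Zcomp> \<rho>\<^sup>* (A \<otimes> B)\<close>, which is \<open>\<rho>\<^sup>* (B \<otimes> A)\<close> by naturality of \<open>\<rho>\<^sup>*\<close>.
\<close>

lemma is_iso_hom: "is_iso C A B f \<Longrightarrow> f \<in> Hom\<^bsub>C\<^esub> A B"
  by (simp add: is_iso_def)

context category
begin

lemma comp_iso:
  assumes "is_iso C A B f" "is_iso C B D g"
  shows "is_iso C A D (f \<Zcomp> g)"
proof -
  obtain f' where f: "f \<in> Hom A B" "f' \<in> Hom B A" "f \<Zcomp> f' = \<^bold>1 A" "f' \<Zcomp> f = \<^bold>1 B"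
    using assms(1) by (auto simp: is_iso_def)
  obtain g' where g: "g \<in> Hom B D" "g' \<in> Hom D B" "g \<Zcomp> g' = \<^bold>1 B" "g' \<Zcomp> g = \<^bold>1 D"
    using assms(2) by (auto simp: is_iso_def)
  have fg: "f \<Zcomp> g \<in> Hom A D" and gf: "g' \<Zcomp> f' \<in> Hom D A"
    using f g comp_hom by blast+
  have "(f \<Zcomp> g) \<Zcomp> (g' \<Zcomp> f') = f \<Zcomp> ((g \<Zcomp> g') \<Zcomp> f')"
    using comp_assoc[OF f(1) g(1) gf] comp_assoc[OF g(1,2) f(2)] by simp
  also have "\<dots> = \<^bold>1 A"
    using f g by (simp add: ident_comp[OF f(2)])
  finally have 1: "(f \<Zcomp> g) \<Zcomp> (g' \<Zcomp> f') = \<^bold>1 A" .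
  have "(g' \<Zcomp> f') \<Zcomp> (f \<Zcomp> g) = g' \<Zcomp> ((f' \<Zcomp> f) \<Zcomp> g)"
    using comp_assoc[OF g(2) f(2) fg] comp_assoc[OF f(2,1) g(1)] by simp
  also have "\<dots> = \<^bold>1 D"
    using f g by (simp add: ident_comp[OF g(1)])
  finally show ?thesis
    using 1 fg gf by (auto simp: is_iso_def)
qed

text \<open>Isomorphisms are epi: composing with the inverse \<open>f'\<close> on the left strips
  \<open>f\<close>. This removes the isomorphism precomposed to both sides of XVII.\<close>

lemma iso_left_cancel:
  assumes "is_iso C A B f" and g: "g \<in> Hom B D" and h: "h \<in> Hom B D" and eq: "f \<Zcomp> g = f \<Zcomp> h"
  shows "g = h"
proof -
  obtain f' where f: "f \<in> Hom A B" "f' \<in> Hom B A" "f' \<Zcomp> f = \<^bold>1 B"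
    using assms(1) by (auto simp: is_iso_def)
  have "g = f' \<Zcomp> (f \<Zcomp> g)"
    using comp_assoc[OF f(2,1) g] f(3) ident_comp[OF g] by simp
  also have "\<dots> = h"
    using comp_assoc[OF f(2,1) h] f(3) ident_comp[OF h] eq by simp
  finally show ?thesis .
qed

end

text \<open>Placed in the common part of the two contexts, so that one argument covers monic and
  invertible distributivities alike.\<close>

lemma (in distributive_setting) XVIII_imp_XVII:
  assumes XV: "\<And>A. A \<in> Obj L \<Longrightarrow> \<lambda>\<^sup>* A = \<gamma>\<^sup>\<otimes> \<zero> A \<Zcomp> \<rho>\<^sup>* A"
    and XVIII: "\<And>A B. \<lbrakk>A \<in> Obj L; B \<in> Obj L\<rbrakk> \<Longrightarrow>
      \<rho>\<^sup>* (A \<otimes> B) = \<alpha>\<^sup>\<otimes> A B \<zero> \<Zcomp> (\<^bold>1 A \<otimes>\<^sub>a \<rho>\<^sup>* B) \<Zcomp> \<rho>\<^sup>* A"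
    and A: "A \<in> Obj L" and B: "B \<in> Obj L"
  shows "(\<rho>\<^sup>* A \<otimes>\<^sub>a \<^bold>1 B) \<Zcomp> \<lambda>\<^sup>* B = \<alpha>\<^sup>\<otimes> A \<zero> B \<Zcomp> (\<^bold>1 A \<otimes>\<^sub>a \<lambda>\<^sup>* B) \<Zcomp> \<rho>\<^sup>* A"
proof -
  note Z = plus.unit_obj
  note obj = A B Z times.ten_obj
  \<comment> \<open>The category laws hold only for arrows of matching type, so every regrouping
    below needs the explicit typings collected from here on.\<close>
  note \<alpha>_hom = is_iso_hom[OF times.\<alpha>_iso]
    and \<gamma>_hom = is_iso_hom[OF times.\<gamma>_iso]
    and \<rho>_hom = is_iso_hom[OF rnull_iso]
  let ?\<alpha> = "\<alpha>\<^sup>\<otimes> B A \<zero>" and ?\<gamma> = "\<gamma>\<^sup>\<otimes> B (A \<otimes> \<zero>)"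
  let ?l = "(\<rho>\<^sup>* A \<otimes>\<^sub>a \<^bold>1 B) \<Zcomp> \<lambda>\<^sup>* B"
    and ?r = "\<alpha>\<^sup>\<otimes> A \<zero> B \<Zcomp> (\<^bold>1 A \<otimes>\<^sub>a \<lambda>\<^sup>* B) \<Zcomp> \<rho>\<^sup>* A"
  have \<alpha>: "?\<alpha> \<in> Hom ((B \<otimes> A) \<otimes> \<zero>) (B \<otimes> (A \<otimes> \<zero>))"
    and \<alpha>1: "\<alpha>\<^sup>\<otimes> A \<zero> B \<in> Hom ((A \<otimes> \<zero>) \<otimes> B) (A \<otimes> (\<zero> \<otimes> B))"
    and \<alpha>2: "\<alpha>\<^sup>\<otimes> A B \<zero> \<in> Hom ((A \<otimes> B) \<otimes> \<zero>) (A \<otimes> (B \<otimes> \<zero>))"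
    and \<gamma>: "?\<gamma> \<in> Hom (B \<otimes> (A \<otimes> \<zero>)) ((A \<otimes> \<zero>) \<otimes> B)"
    and \<gamma>': "\<gamma>\<^sup>\<otimes> (A \<otimes> \<zero>) B \<in> Hom ((A \<otimes> \<zero>) \<otimes> B) (B \<otimes> (A \<otimes> \<zero>))"
    and \<gamma>0: "\<gamma>\<^sup>\<otimes> \<zero> B \<in> Hom (\<zero> \<otimes> B) (B \<otimes> \<zero>)"
    and \<gamma>1: "\<gamma>\<^sup>\<otimes> B \<zero> \<in> Hom (B \<otimes> \<zero>) (\<zero> \<otimes> B)"
    and \<gamma>2: "\<gamma>\<^sup>\<otimes> B A \<in> Hom (B \<otimes> A) (A \<otimes> B)"
    and \<rho>A: "\<rho>\<^sup>* A \<in> Hom (A \<otimes> \<zero>) \<zero>"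
    and \<rho>B: "\<rho>\<^sup>* B \<in> Hom (B \<otimes> \<zero>) \<zero>"
    and \<rho>BA: "\<rho>\<^sup>* (B \<otimes> A) \<in> Hom ((B \<otimes> A) \<otimes> \<zero>) \<zero>"
    and nullB: "\<lambda>\<^sup>* B \<in> Hom (\<zero> \<otimes> B) \<zero>"
    by (intro \<alpha>_hom \<gamma>_hom \<rho>_hom is_iso_hom[OF lnull_iso] obj)+
  note iA = ident_hom[OF A] and iB = ident_hom[OF B] and iZ = ident_hom[OF Z]
  note \<rho>A_B = times.tena_hom[OF \<rho>A iB] and B_\<rho>A = times.tena_hom[OF iB \<rho>A]
    and A_\<rho>B = times.tena_hom[OF iA \<rho>B] and A_nullB = times.tena_hom[OF iA nullB]
    and A_\<gamma>1 = times.tena_hom[OF iA \<gamma>1]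
    and \<gamma>2_Z = times.tena_hom[OF \<gamma>2 iZ]
  have l_hom: "?l \<in> Hom ((A \<otimes> \<zero>) \<otimes> B) \<zero>"
    by (rule comp_hom[OF \<rho>A_B nullB])
  have r_hom: "?r \<in> Hom ((A \<otimes> \<zero>) \<otimes> B) \<zero>"
    by (rule comp_hom[OF comp_hom[OF \<alpha>1 A_nullB] \<rho>A])
  \<comment> \<open>The target of this isomorphism is the common source of the two sides of
    XVII.\<close>
  have \<alpha>\<gamma>_iso: "is_iso L ((B \<otimes> A) \<otimes> \<zero>) ((A \<otimes> \<zero>) \<otimes> B) (?\<alpha> \<Zcomp> ?\<gamma>)"
    by (intro comp_iso[OF times.\<alpha>_iso times.\<gamma>_iso] obj)
  note \<alpha>\<gamma> = is_iso_hom[OF \<alpha>\<gamma>_iso]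
  \<comment> \<open>XV replaces \<open>\<lambda>\<^sup>* B\<close>, and naturality of the symmetry
    at the pair of \<open>\<rho>\<^sup>* A\<close> and the identity of \<open>B\<close> moves the
    symmetry to the front, where its inverse \<open>?\<gamma>\<close> can cancel it.\<close>
  have l_eq: "?l = \<gamma>\<^sup>\<otimes> (A \<otimes> \<zero>) B \<Zcomp> ((\<^bold>1 B \<otimes>\<^sub>a \<rho>\<^sup>* A) \<Zcomp> \<rho>\<^sup>* B)"
    unfolding XV[OF B]
    using comp_assoc[OF \<rho>A_B \<gamma>0 \<rho>B] times.\<gamma>_natural[OF \<rho>A iB] comp_assoc[OF \<gamma>' B_\<rho>A \<rho>B]
    by simp
  have "?\<gamma> \<Zcomp> ?l = (?\<gamma> \<Zcomp> \<gamma>\<^sup>\<otimes> (A \<otimes> \<zero>) B) \<Zcomp> ((\<^bold>1 B \<otimes>\<^sub>a \<rho>\<^sup>* A) \<Zcomp> \<rho>\<^sup>* B)"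
    unfolding l_eq by (rule comp_assoc[OF \<gamma> \<gamma>' comp_hom[OF B_\<rho>A \<rho>B], symmetric])
  also have "\<dots> = (\<^bold>1 B \<otimes>\<^sub>a \<rho>\<^sup>* A) \<Zcomp> \<rho>\<^sup>* B"
    using times.symmetry[OF B times.ten_obj[OF A Z]] ident_comp[OF comp_hom[OF B_\<rho>A \<rho>B]]
    by simp
  \<comment> \<open>With \<open>?\<alpha>\<close> in front, the remaining composite is XVIII with
    \<open>A\<close> and \<open>B\<close> exchanged.\<close>
  finally have "(?\<alpha> \<Zcomp> ?\<gamma>) \<Zcomp> ?l = \<rho>\<^sup>* (B \<otimes> A)"
    using comp_assoc[OF \<alpha> \<gamma> l_hom] comp_assoc[OF \<alpha> B_\<rho>A \<rho>B] XVIII[OF B A] by simp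
  \<comment> \<open>The target of the nullary distributivity is constantly \<open>\<zero>\<close>,
    so its naturality square at \<open>\<gamma>\<^sup>\<otimes> B A\<close> ends in an identity,
    which drops out.\<close>
  also have "\<rho>\<^sup>* (B \<otimes> A) = (\<gamma>\<^sup>\<otimes> B A \<otimes>\<^sub>a \<^bold>1 \<zero>) \<Zcomp> \<rho>\<^sup>* (A \<otimes> B)"
    using rnull_natural[OF \<gamma>2] comp_ident[OF \<rho>BA] by simp
  also have "\<dots> = (?\<alpha> \<Zcomp> ?\<gamma>) \<Zcomp> ?r"
  proof -
    have "(\<^bold>1 A \<otimes>\<^sub>a \<gamma>\<^sup>\<otimes> B \<zero>) \<Zcomp> (\<^bold>1 A \<otimes>\<^sub>a \<lambda>\<^sup>* B) = \<^bold>1 A \<otimes>\<^sub>a (\<gamma>\<^sup>\<otimes> B \<zero> \<Zcomp> \<lambda>\<^sup>* B)"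
      using times.tena_comp[OF iA iA \<gamma>1 nullB] ident_comp[OF iA] by simp
    \<comment> \<open>Expanding by XV gives two mutually inverse symmetries in a row. The resulting
      identity absorbs the last factor that the hexagon produces.\<close>
    also have "\<gamma>\<^sup>\<otimes> B \<zero> \<Zcomp> \<lambda>\<^sup>* B = \<rho>\<^sup>* B"
      unfolding XV[OF B]
      using comp_assoc[OF \<gamma>1 \<gamma>0 \<rho>B] times.symmetry[OF B Z] ident_comp[OF \<rho>B] by simp
    finally have \<gamma>_null: "(\<^bold>1 A \<otimes>\<^sub>a \<gamma>\<^sup>\<otimes> B \<zero>) \<Zcomp> (\<^bold>1 A \<otimes>\<^sub>a \<lambda>\<^sup>* B) = \<^bold>1 A \<otimes>\<^sub>a \<rho>\<^sup>* B" .
    note null = comp_hom[OF A_nullB \<rho>A]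
    \<comment> \<open>Regrouping exposes the left side of the hexagon for \<open>B\<close>,
      \<open>A\<close>, \<open>\<zero>\<close>.\<close>
    have "(?\<alpha> \<Zcomp> ?\<gamma>) \<Zcomp> ?r = (?\<alpha> \<Zcomp> ?\<gamma> \<Zcomp> \<alpha>\<^sup>\<otimes> A \<zero> B) \<Zcomp> ((\<^bold>1 A \<otimes>\<^sub>a \<lambda>\<^sup>* B) \<Zcomp> \<rho>\<^sup>* A)"
      using comp_assoc[OF \<alpha>1 A_nullB \<rho>A] comp_assoc[OF \<alpha>\<gamma> \<alpha>1 null] by simp
    also have "\<dots> = ((\<gamma>\<^sup>\<otimes> B A \<otimes>\<^sub>a \<^bold>1 \<zero>) \<Zcomp> \<alpha>\<^sup>\<otimes> A B \<zero> \<Zcomp> (\<^bold>1 A \<otimes>\<^sub>a \<gamma>\<^sup>\<otimes> B \<zero>))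
        \<Zcomp> ((\<^bold>1 A \<otimes>\<^sub>a \<lambda>\<^sup>* B) \<Zcomp> \<rho>\<^sup>* A)"
      by (simp only: times.hexagon[OF B A Z])
    also have "\<dots> = ((\<gamma>\<^sup>\<otimes> B A \<otimes>\<^sub>a \<^bold>1 \<zero>) \<Zcomp> \<alpha>\<^sup>\<otimes> A B \<zero>) \<Zcomp> ((\<^bold>1 A \<otimes>\<^sub>a \<rho>\<^sup>* B) \<Zcomp> \<rho>\<^sup>* A)"
      using comp_assoc[OF comp_hom[OF \<gamma>2_Z \<alpha>2] A_\<gamma>1 null] comp_assoc[OF A_\<gamma>1 A_nullB \<rho>A] \<gamma>_null
      by simp
    also have "\<dots> = (\<gamma>\<^sup>\<otimes> B A \<otimes>\<^sub>a \<^bold>1 \<zero>) \<Zcomp> \<rho>\<^sup>* (A \<otimes> B)"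
      unfolding XVIII[OF A B]
      using comp_assoc[OF \<gamma>2_Z \<alpha>2 comp_hom[OF A_\<rho>B \<rho>A]] comp_assoc[OF \<alpha>2 A_\<rho>B \<rho>A] by simp
    finally show ?thesis ..
  qed
  finally show ?thesis
    by (rule iso_left_cancel[OF \<alpha>\<gamma>_iso l_hom r_hom])
qed

theorem proposition11:
  fixes L :: "('o, 'a) bimonoidal" (structure)
  assumes setting: "laplaza_mono_setting L \<or> laplaza_iso_setting L"
    and XV: "\<forall>A \<in> Obj L. \<lambda>\<^sup>* A = \<gamma>\<^sup>\<otimes> \<zero> A \<Zcomp> \<rho>\<^sup>* A"
    and XVIII: "\<forall>A \<in> Obj L. \<forall>B \<in> Obj L.
      \<rho>\<^sup>* (A \<otimes> B) = \<alpha>\<^sup>\<otimes> A B \<zero> \<Zcomp> (\<^bold>1 A \<otimes>\<^sub>a \<rho>\<^sup>* B) \<Zcomp> \<rho>\<^sup>* A"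
  shows "\<forall>A \<in> Obj L. \<forall>B \<in> Obj L.
      (\<rho>\<^sup>* A \<otimes>\<^sub>a \<^bold>1 B) \<Zcomp> \<lambda>\<^sup>* B = \<alpha>\<^sup>\<otimes> A \<zero> B \<Zcomp> (\<^bold>1 A \<otimes>\<^sub>a \<lambda>\<^sup>* B) \<Zcomp> \<rho>\<^sup>* A"
proof -
  \<comment> \<open>Both disjuncts extend this locale, so no case split is needed later.\<close>
  interpret distributive_setting L
    using setting laplaza_mono_setting.axioms(1) laplaza_iso_setting.axioms(1) by blast
  show ?thesis
    using XVIII_imp_XVII XV XVIII by blast
qed

end
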